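(* Let $\pi$ be a nonempty noncrossing partition such that $\pi=\mathrm{Base}(\pi)$. Then $\phi_{\mathcal{NCP}}(\pi)$ is a polynomial $P_{|\pi|}$ which depends only on $|\pi|$, where the sequence $(P_k)_{k\ge0}$ is characterized by $P_0(X)=1$ and $$\forall k\ge1,\qquad\begin{cases}P_k(X+1)=P_k(X)+\displaystyle\sum_{i=1}^kP_{i-1}(X)P_{k-i}(X),\\ P_k(0)=0.\end{cases}$$
   Context: $\mathbb{K}$ is a field of characteristic zero. A noncrossing partition is a partition $\pi$ of a set $[n]=\{1,\ldots,n\}$, $n\ge1$, into nonempty blocks such that there are no distinct blocks $b\ne b'$ and $x,z\in b$, $y,t\in b'$ with $x<y<z<t$. $|\pi|$ is its number of blocks; $\mathcal{NCP}$ is the set of all noncrossing partitions. For a nonempty set $Y$ of blocks of $\pi$, $\pi_{\mid Y}$ is the noncrossing partition obtained by deleting the blocks not in $Y$ and renumbering the remaining elements increasingly; $\pi_{\mid\emptyset}=1$. The nesting order on blocks is $b\le_\pi b'\iff b'\subseteq[\min b,\max b]$; $\mathrm{Base}(\pi)$ is the set of blocks of $\pi$ minimal for $\le_\pi$ (so $\pi=\mathrm{Base}(\pi)$ means that no block is nested in another one). An ideal of $\pi$ is a set $J$ of blocks that is upward closed for $\le_\pi$; then the union of its blocks decomposes into maximal subsets of consecutive integers $I_1,\ldots,I_k$, each a union of blocks, and $\pi_{\mid_\cdot J}=\prod_i\pi_{\mid I_i}$ (restriction to the blocks contained in $I_i$; product $\cdot$ below). $\mathbb{K}[\mathcal{NCP}]$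 is the free commutative algebra generated by $\mathcal{NCP}$, with product $\cdot$ and unit $1$. It carries two coproducts which are algebra morphisms, given on $\pi\in\mathcal{NCP}$ by $\Delta(\pi)=\sum_{J\text{ ideal of }\pi}\pi_{\mid\pi\setminus J}\otimes\pi_{\mid_\cdot J}$ and $\delta(\pi)=\sum_{\sim\in\mathcal{E}_c[\pi]}\pi/\!\sim\,\otimes\,\pi\mid_\cdot\sim$, where, for an equivalence $\sim$ on the set of blocks of $\pi$, $\pi/\!\sim$ is the partition whose blocks are the unions of the blocks in each class, $\mathcal{E}_c[\pi]$ is the set of $\sim$ for which $\pi/\!\sim$ is noncrossing, and $\pi\mid_\cdot\sim=\prod_{C\text{ class of }\sim}\pi_{\mid C}$. The counits are the algebra morphisms with $\varepsilon_\Delta(\pi)=0$, and $\epsilon_\delta(\pi)=1$ if $|\pi|=1$, $\epsilon_\delta(\pi)=0$ otherwise. $\mathbb{K}[X]$ has the multiplicative coproducts $\Delta(X)=X\otimes1+1\otimes X$, $\delta(X)=X\otimes X$ with counits $P\mapsto P(0)$, $P\mapsto P(1)$. $\phi_{\mathcal{NCP}}:\mathbb{K}[\mathcal{NCP}]\to\mathbb{K}[X]$ is the unique algebra morphism compatible with both coproducts $\Delta,\delta$ and both counits. By known results it exists, is unique, and for $x\in\ker\varepsilon_\Delta$, $\phi_{\mathcal{NCP}}(x)=\sum_{k\ge1}\epsilon_\delta^{\otimes k}\circ\tilde\Delta^{(k-1)}(x)\,H_k(X)$, with $\tilde\Delta(x)=\Delta(x)-x\otimes1-1\otimes x$, $\tilde\Delta^{(k-1)}$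 its iterates ($\tilde\Delta^{(0)}=\mathrm{Id}$), and $H_k(X)=X(X-1)\cdots(X-k+1)/k!$. *)

theory Defs
  imports
    "HOL-Library.Poly_Mapping"
    "HOL-Library.Product_Plus"
    "HOL-Library.Multiset"
    "HOL-Library.Disjoint_Sets"
    "HOL-Computational_Algebra.Polynomial"
begin

section \<open>Noncrossing partitions\<close>

definition noncrossing :: "nat set set \<Rightarrow> bool" where
  "noncrossing p \<longleftrightarrow>
     \<not> (\<exists>b\<in>p. \<exists>b'\<in>p. b \<noteq> b' \<and>
          (\<exists>x\<in>b. \<exists>z\<in>b. \<exists>y\<in>b'. \<exists>t\<in>b'. x < y \<and> y < z \<and> z < t))"

definition is_ncp :: "nat set set \<Rightarrow> bool" where
  "is_ncp p \<longleftrightarrow> (\<exists>n\<ge>1. partition_on {1..n} p) \<and> noncrossing p"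

typedef ncp = "{p. is_ncp p}"
  morphisms blocks Abs_ncp
proof
  have "partition_on {1..1::nat} {{1}}"
    by (simp add: partition_on_def)
  then have "\<exists>n\<ge>1. partition_on {1..n::nat} {{1}}"
    by (intro exI[of _ 1]) simp
  then show "{{1}} \<in> {p. is_ncp p}"
    by (simp add: is_ncp_def noncrossing_def)
qed

definition nests :: "nat set \<Rightarrow> nat set \<Rightarrow> bool" where
  "nests b b' \<longleftrightarrow> b' \<subseteq> {Min b..Max b}"

definition Base :: "ncp \<Rightarrow> nat set set" where
  "Base \<pi> = {b \<in> blocks \<pi>. \<forall>b'\<in>blocks \<pi>. nests b' b \<longrightarrow> b' = b}"

definition ideals :: "ncp \<Rightarrow> nat set set set" where
  "ideals \<pi> = {J. J \<subseteq> blocks \<pi> \<and>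
     (\<forall>b\<in>J. \<forall>b'\<in>blocks \<pi>. nests b b' \<longrightarrow> b' \<in> J)}"

definition relabel :: "nat set set \<Rightarrow> nat set set" where
  "relabel Y = (\<lambda>b. (\<lambda>x. card {y \<in> \<Union>Y. y \<le> x}) ` b) ` Y"

definition intervals :: "nat set \<Rightarrow> nat set set" where
  "intervals U = {I. I \<noteq> {} \<and> I \<subseteq> U \<and> (\<exists>a b. I = {a..b}) \<and>
     (\<forall>a b. I \<subseteq> {a..b} \<and> {a..b} \<subseteq> U \<longrightarrow> {a..b} = I)}"

definition coarsen :: "nat set rel \<Rightarrow> ncp \<Rightarrow> nat set set" where
  "coarsen r \<pi> = \<Union> ` (blocks \<pi> // r)"

definition Ec :: "ncp \<Rightarrow> nat set rel set" where
  "Ec \<pi> = {r. equiv (blocks \<pi>) r \<and> noncrossing (coarsen r \<pi>)}"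

text \<open>
  The arguments to which \<open>Abs_ncp\<close> is applied below are indeed noncrossing partitions.
\<close>

lemma is_ncp_relabel:
  assumes Y: "Y \<subseteq> blocks \<pi>" "Y \<noteq> {}"
  shows "is_ncp (relabel Y)"
proof -
  have "is_ncp (blocks \<pi>)"
    using blocks[of \<pi>] by simp
  then obtain n where P: "partition_on {1..n} (blocks \<pi>)" and nc: "noncrossing (blocks \<pi>)"
    unfolding is_ncp_def by blast
  define U where "U = \<Union>Y"
  define g where "g x = card {y \<in> U. y \<le> x}" for x :: nat
  have U_sub: "U \<subseteq> {1..n}"
    using P Y unfolding U_def partition_on_def by blast
  then have fin: "finite U"
    using finite_subset by blast
  have "b \<noteq> {}" if "b \<in> Y" for b
    using that Y partition_onD3[OF P] by blast
  then have U_ne: "U \<noteq> {}"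
    using Y(2) unfolding U_def by blast
  have g_less: "g x < g y" if "x < y" "y \<in> U" for x y
    unfolding g_def
  proof (rule psubset_card_mono)
    show "finite {z \<in> U. z \<le> y}" using fin by simp
    have "{z \<in> U. z \<le> x} \<subseteq> {z \<in> U. z \<le> y}"
      using that by auto
    moreover have "y \<notin> {z \<in> U. z \<le> x}" "y \<in> {z \<in> U. z \<le> y}"
      using that by auto
    ultimately show "{z \<in> U. z \<le> x} \<subset> {z \<in> U. z \<le> y}"
      by blast
  qed
  have inj: "inj_on g U"
    by (rule inj_onI) (metis g_less linorder_neqE_nat less_irrefl)
  have g_less_iff: "g x < g y \<longleftrightarrow> x < y" if "x \<in> U" "y \<in> U" for x y
    by (metis that g_less linorder_neqE_nat less_irrefl less_asym)
  have "g ` U \<subseteq> {1..card U}"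
  proof
    fix k assume "k \<in> g ` U"
    then obtain x where x: "x \<in> U" "k = g x" by blast
    have "{y \<in> U. y \<le> x} \<noteq> {}" using x by blast
    then have "0 < k" unfolding x(2) g_def using fin by (simp add: card_gt_0_iff)
    moreover have "k \<le> card U"
      unfolding x(2) g_def using fin by (intro card_mono) auto
    ultimately show "k \<in> {1..card U}" by simp
  qed
  then have img: "g ` U = {1..card U}"
    using card_image[OF inj] by (intro card_subset_eq) auto
  have rel: "relabel Y = (\<lambda>b. g ` b) ` Y"
    unfolding relabel_def g_def U_def by simp
  have sub: "b \<subseteq> U" if "b \<in> Y" for b
    using that unfolding U_def by blast
  have "partition_on {1..card U} (relabel Y)"
  proof (rule partition_onI)
    show "\<Union>(relabel Y) = {1..card U}"
      using img unfolding rel U_def by (simp add: image_Union)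
    show "{} \<notin> relabel Y"
      using P Y unfolding rel partition_on_def by auto
    fix p q assume pq: "p \<in> relabel Y" "q \<in> relabel Y" "p \<noteq> q"
    then obtain b c where bc: "b \<in> Y" "c \<in> Y" "p = g ` b" "q = g ` c" "b \<noteq> c"
      unfolding rel by blast
    have "b \<inter> c = {}"
      using P Y bc unfolding partition_on_def disjoint_def by blast
    then have "g ` b \<inter> g ` c = {}"
      using inj_on_image_Int[OF inj sub[OF bc(1)] sub[OF bc(2)]] by simp
    then show "disjnt p q"
      using bc by (simp add: disjnt_def)
  qed
  moreover have "card U \<ge> 1"
    using fin U_ne by (simp add: Suc_le_eq card_gt_0_iff)
  moreover have "noncrossing (relabel Y)"
    unfolding noncrossing_def
  proof (rule notI, elim bexE conjE)
    fix p q x z y t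
    assume a: "p \<in> relabel Y" "q \<in> relabel Y" "p \<noteq> q" "x \<in> p" "z \<in> p" "y \<in> q" "t \<in> q"
      "x < y" "y < z" "z < t"
    then obtain b c where bc: "b \<in> Y" "c \<in> Y" "p = g ` b" "q = g ` c" "b \<noteq> c"
      unfolding rel by blast
    then obtain x' z' y' t' where
      m: "x' \<in> b" "z' \<in> b" "y' \<in> c" "t' \<in> c" "x = g x'" "z = g z'" "y = g y'" "t = g t'"
      using a by blast
    have lt: "x' < y'" "y' < z'" "z' < t'"
      using a sub bc m g_less_iff by (metis subsetD)+
    have "b \<in> blocks \<pi>" "c \<in> blocks \<pi>"
      using bc Y by auto
    with nc bc(5) m(1-4) lt show False
      unfolding noncrossing_def by metis
  qed
  ultimately show ?thesis
    unfolding is_ncp_def by blast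
qed

lemma is_ncp_coarsen:
  assumes r: "r \<in> Ec \<pi>"
  shows "is_ncp (coarsen r \<pi>)"
proof -
  have e: "equiv (blocks \<pi>) r" and nc: "noncrossing (coarsen r \<pi>)"
    using r unfolding Ec_def by auto
  have "is_ncp (blocks \<pi>)"
    using blocks[of \<pi>] by simp
  then obtain n where n: "n \<ge> 1" and P: "partition_on {1..n} (blocks \<pi>)"
    unfolding is_ncp_def by blast
  have sub: "C \<subseteq> blocks \<pi>" if "C \<in> blocks \<pi> // r" for C
    using e that in_quotient_imp_subset by blast
  have "partition_on {1..n} (coarsen r \<pi>)"
  proof (rule partition_onI)
    show "\<Union>(coarsen r \<pi>) = {1..n}"
    proof -
      have "\<Union>(coarsen r \<pi>) = \<Union>(\<Union>(blocks \<pi> // r))"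
        unfolding coarsen_def by blast
      then show ?thesis
        using Union_quotient[OF e] partition_onD1[OF P] by simp
    qed
    show "{} \<notin> coarsen r \<pi>"
    proof
      assume "{} \<in> coarsen r \<pi>"
      then obtain C where C: "C \<in> blocks \<pi> // r" "\<Union>C = {}"
        unfolding coarsen_def by auto
      then obtain b where "b \<in> C"
        using in_quotient_imp_non_empty[OF e] by blast
      then show False
        using C sub[OF C(1)] partition_onD3[OF P] by (metis Union_upper subset_empty subsetD)
    qed
    fix p q assume pq: "p \<in> coarsen r \<pi>" "q \<in> coarsen r \<pi>" "p \<noteq> q"
    then obtain C D where CD: "C \<in> blocks \<pi> // r" "D \<in> blocks \<pi> // r" "p = \<Union>C" "q = \<Union>D"
      unfolding coarsen_def by blast
    then have "C \<inter> D = {}"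
      using quotient_disj[OF e] pq by blast
    have "b \<inter> c = {}" if "b \<in> C" "c \<in> D" for b c
    proof -
      have "b \<in> blocks \<pi>" "c \<in> blocks \<pi>" "b \<noteq> c"
        using that sub[OF CD(1)] sub[OF CD(2)] \<open>C \<inter> D = {}\<close> by auto
      then show ?thesis
        by (rule disjointD[OF partition_onD2[OF P]])
    qed
    then show "disjnt p q"
      unfolding CD disjnt_def by blast
  qed
  then show ?thesis
    using n nc unfolding is_ncp_def by blast
qed

section \<open>The algebra of noncrossing partitions\<close>

text \<open>
  The free commutative algebra on noncrossing partitions is the monoid algebra of the free
  commutative monoid \<open>ncp multiset\<close> (the product of \<open>\<Rightarrow>\<^sub>0\<close> is convolution).  Its tensor
  square has the pairs of monomials as a basis, hence is the monoid algebra of the product monoid.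
\<close>

type_synonym 'k KNCP = "ncp multiset \<Rightarrow>\<^sub>0 'k"
type_synonym 'k KNCP_tensor = "(ncp multiset \<times> ncp multiset) \<Rightarrow>\<^sub>0 'k"

definition monomial :: "ncp multiset \<Rightarrow> 'k::field KNCP" where
  "monomial m = Poly_Mapping.single m 1"

definition gen :: "ncp \<Rightarrow> 'k::field KNCP" where
  "gen \<pi> = monomial {#\<pi>#}"

definition tensor :: "'k::field KNCP \<Rightarrow> 'k KNCP \<Rightarrow> 'k KNCP_tensor" where
  "tensor a b = (\<Sum>m\<in>Poly_Mapping.keys a. \<Sum>n\<in>Poly_Mapping.keys b.
     Poly_Mapping.single (m, n) (Poly_Mapping.lookup a m * Poly_Mapping.lookup b n))"

text \<open>
  The algebra morphism out of \<open>'k KNCP\<close> with given values \<open>f\<close> on the generators; the target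
  algebra is given by its structure map \<open>\<iota>\<close> from the field.
\<close>

definition extend :: "('k \<Rightarrow> 'a) \<Rightarrow> (ncp \<Rightarrow> 'a) \<Rightarrow> 'k::field KNCP \<Rightarrow> 'a::comm_ring_1" where
  "extend \<iota> f a = (\<Sum>m\<in>Poly_Mapping.keys a. \<iota> (Poly_Mapping.lookup a m) * (\<Prod>\<pi>\<in>#m. f \<pi>))"

definition restrict :: "nat set set \<Rightarrow> 'k::field KNCP" where
  "restrict Y = (if Y = {} then 1 else gen (Abs_ncp (relabel Y)))"

definition restrict_ideal :: "nat set set \<Rightarrow> 'k::field KNCP" where
  "restrict_ideal J = (\<Prod>I\<in>intervals (\<Union>J). restrict {b \<in> J. b \<subseteq> I})"

definition Delta_NCP :: "'k::field KNCP \<Rightarrow> 'k KNCP_tensor" where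
  "Delta_NCP = extend (Poly_Mapping.single 0)
     (\<lambda>\<pi>. \<Sum>J\<in>ideals \<pi>. tensor (restrict (blocks \<pi> - J)) (restrict_ideal J))"

definition delta_NCP :: "'k::field KNCP \<Rightarrow> 'k KNCP_tensor" where
  "delta_NCP = extend (Poly_Mapping.single 0)
     (\<lambda>\<pi>. \<Sum>r\<in>Ec \<pi>. tensor (gen (Abs_ncp (coarsen r \<pi>))) (\<Prod>C\<in>blocks \<pi> // r. restrict C))"

definition eps_Delta :: "'k::field KNCP \<Rightarrow> 'k" where
  "eps_Delta = extend (\<lambda>c. c) (\<lambda>\<pi>. 0)"

definition eps_delta :: "'k::field KNCP \<Rightarrow> 'k" where
  "eps_delta = extend (\<lambda>c. c) (\<lambda>\<pi>. if card (blocks \<pi>) = 1 then 1 else 0)"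

section \<open>The polynomial double bialgebra\<close>

text \<open>
  The tensor square of the polynomial algebra is \<open>'k poly poly\<close>: the inner variable is
  \<open>X \<otimes> 1\<close>, the outer one is \<open>1 \<otimes> X\<close>.
\<close>

definition poly_tensor :: "'k::field poly \<Rightarrow> 'k poly \<Rightarrow> 'k poly poly" where
  "poly_tensor p q = [:p:] * map_poly (\<lambda>c. [:c:]) q"

definition X :: "'k::field poly" where
  "X = [:0, 1:]"

definition Delta_poly :: "'k::field poly \<Rightarrow> 'k poly poly" where
  "Delta_poly p = poly (map_poly (\<lambda>c. [:[:c:]:]) p) (poly_tensor X 1 + poly_tensor 1 X)"

definition delta_poly :: "'k::field poly \<Rightarrow> 'k poly poly" where
  "delta_poly p = poly (map_poly (\<lambda>c. [:[:c:]:]) p) (poly_tensor X X)"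

section \<open>Morphisms of double bialgebras\<close>

text \<open>For a linear map \<open>\<phi>\<close>, this is the linear map \<open>\<phi> \<otimes> \<phi>\<close>.\<close>

definition tensor_map :: "('k::field KNCP \<Rightarrow> 'k poly) \<Rightarrow> 'k KNCP_tensor \<Rightarrow> 'k poly poly" where
  "tensor_map \<phi> t = (\<Sum>(m, n)\<in>Poly_Mapping.keys t.
     [:[:Poly_Mapping.lookup t (m, n):]:] * poly_tensor (\<phi> (monomial m)) (\<phi> (monomial n)))"

definition algebra_morphism :: "('k::field KNCP \<Rightarrow> 'k poly) \<Rightarrow> bool" where
  "algebra_morphism \<phi> \<longleftrightarrow>
     (\<forall>c. \<phi> (Poly_Mapping.single 0 c) = [:c:]) \<and>
     (\<forall>a b. \<phi> (a + b) = \<phi> a + \<phi> b) \<and>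
     (\<forall>a b. \<phi> (a * b) = \<phi> a * \<phi> b)"

definition double_bialgebra_morphism :: "('k::field KNCP \<Rightarrow> 'k poly) \<Rightarrow> bool" where
  "double_bialgebra_morphism \<phi> \<longleftrightarrow>
     algebra_morphism \<phi> \<and>
     (\<forall>a. Delta_poly (\<phi> a) = tensor_map \<phi> (Delta_NCP a)) \<and>
     (\<forall>a. delta_poly (\<phi> a) = tensor_map \<phi> (delta_NCP a)) \<and>
     (\<forall>a. poly (\<phi> a) 0 = eps_Delta a) \<and>
     (\<forall>a. poly (\<phi> a) 1 = eps_delta a)"

section \<open>The recursion\<close>

definition recursion :: "(nat \<Rightarrow> 'k::field poly) \<Rightarrow> bool" where
  "recursion P \<longleftrightarrow> P 0 = 1 \<and>
     (\<forall>k\<ge>1. pcompose (P k) (X + 1) = P k + (\<Sum>i=1..k. P (i - 1) * P (k - i)) \<and>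
             poly (P k) 0 = 0)"

end

theory Submission
  imports Defs
begin

text \<open>
  Let \<open>\<pi>\<close> have \<open>k\<close> blocks, none nested in another. Noncrossingness then leaves no room for
  interleaving: the blocks are consecutive intervals, and every set of blocks is an ideal. Apply
  \<open>\<phi>\<close> to both sides of the coproduct of \<open>\<pi>\<close> and evaluate at \<open>1\<close> in the left tensor factor and at \<open>x\<close>
  in the right one (\<open>morphism_shift\<close>). The left side becomes \<open>\<phi>(\<pi>)(x + 1)\<close>. In the summand of an
  ideal \<open>J\<close> the left factor turns into the counit of \<open>\<delta>\<close> at the restriction to the complement of
  \<open>J\<close>, and this vanishes as soon as the complement has two blocks.

  What survives is \<open>J = \<pi>\<close>, which contributes \<open>\<phi>(\<pi>)(x)\<close>, and the complements of single blocks.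
  Deleting the \<open>i\<close>-th block from the left splits \<open>\<pi>\<close> into two partitions, again without
  nesting, with \<open>i - 1\<close> and \<open>k - i\<close> blocks (\<open>restrict_ideal_remove_block\<close>). By induction on \<open>k\<close>
  these contribute \<open>P\<^bsub>i-1\<^esub> P\<^bsub>k-i\<^esub>\<close>, so \<open>\<phi>(\<pi>)\<close> solves the same difference equation as \<open>P\<^sub>k\<close>.
  Compatibility with the counit of \<open>\<Delta>\<close> gives \<open>\<phi>(\<pi>)(0) = 0\<close>, and over a field of characteristic
  zero a polynomial is determined by its difference together with its value at \<open>0\<close>.

  The recursion itself has a solution because each polynomial is the difference of some polynomial
  vanishing at \<open>0\<close> (\<open>antidifference_exists\<close>).
\<close>

section \<open>Difference equations for polynomials\<close>

lemma poly_shift: "poly (pcompose p (X + 1)) x = poly p (x + 1)"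
  by (simp add: poly_pcompose X_def algebra_simps)

text \<open>
  Equal differences and equal values at \<open>0\<close> give equal values at all natural numbers, and these
  form an infinite subset of a field of characteristic zero.
\<close>

lemma antidifference_unique:
  fixes p q :: "'k::field_char_0 poly"
  assumes "pcompose p (X + 1) - p = pcompose q (X + 1) - q" and "poly p 0 = poly q 0"
  shows "p = q"
proof -
  have step: "poly p (x + 1) - poly p x = poly q (x + 1) - poly q x" for x
    using arg_cong[OF assms(1), of "\<lambda>r. poly r x"] by (simp add: poly_shift)
  have "poly (p - q) (of_nat n) = 0" for n
  proof (induction n)
    case 0
    show ?case using assms(2) by simp
  next
    case (Suc n)
    then show ?case using step[of "of_nat n"] by (simp add: add.commute)
  qed
  then have "range of_nat \<subseteq> {x. poly (p - q) x = 0}"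
    by blast
  moreover have "infinite (range (of_nat :: nat \<Rightarrow> 'k))"
    by (simp add: infinite_UNIV_char_0 inj_of_nat finite_image_iff)
  ultimately have "p - q = 0"
    using poly_roots_finite[of "p - q"] infinite_super by blast
  then show ?thesis by simp
qed

text \<open>
  The falling factorial \<open>X(X - 1)\<dots>(X - k + 1)\<close>: the difference operator acts on these products as
  differentiation acts on the powers of \<open>X\<close>.
\<close>

definition falling :: "nat \<Rightarrow> 'k::field_char_0 poly" where
  "falling k = (\<Prod>i<k. [:- of_nat i, 1:])"

lemma falling_Suc: "falling (Suc k) = falling k * [:- of_nat k, 1:]"
  by (simp add: falling_def)

lemma falling_shift:
  "pcompose (falling (Suc k) :: 'k::field_char_0 poly) (X + 1) = [:1, 1:] * falling k"
proof (induction k)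
  case 0
  show ?case by (simp add: falling_def X_def one_pCons pcompose_pCons)
next
  case (Suc k)
  have "pcompose [:- of_nat (Suc k), 1 :: 'k:] (X + 1) = [:- of_nat k, 1:]"
    by (simp add: X_def one_pCons pcompose_pCons)
  then have "pcompose (falling (Suc (Suc k)) :: 'k poly) (X + 1) =
      ([:1, 1:] * falling k) * [:- of_nat k, 1:]"
    unfolding falling_Suc[of "Suc k"] pcompose_mult Suc.IH by simp
  then show ?case
    unfolding falling_Suc[of k] mult.assoc .
qed

text \<open>
  The image \<open>D\<close> of the difference operator is a subspace containing every falling factorial, since
  the difference of the \<open>(k + 1)\<close>-st is \<open>k + 1\<close> times the \<open>k\<close>-th. These span all polynomials:
  multiplying the \<open>k\<close>-th by \<open>X\<close> gives the \<open>(k + 1)\<close>-st plus \<open>k\<close> times the \<open>k\<close>-th.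
\<close>

lemma antidifference_exists:
  fixes q :: "'k::field_char_0 poly"
  shows "\<exists>p. pcompose p (X + 1) - p = q \<and> poly p 0 = 0"
proof -
  define D where "D = {q :: 'k poly. \<exists>p. pcompose p (X + 1) - p = q \<and> poly p 0 = 0}"
  have add: "a + b \<in> D" if "a \<in> D" "b \<in> D" for a b
  proof -
    obtain p r where "pcompose p (X + 1) - p = a" "poly p 0 = 0"
      and "pcompose r (X + 1) - r = b" "poly r 0 = 0"
      using \<open>a \<in> D\<close> \<open>b \<in> D\<close> unfolding D_def by blast
    then show ?thesis
      unfolding D_def by (auto intro!: exI[of _ "p + r"] simp: pcompose_add)
  qed
  have scale: "smult c a \<in> D" if "a \<in> D" for a c
  proof -
    obtain p where "pcompose p (X + 1) - p = a" "poly p 0 = 0"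
      using \<open>a \<in> D\<close> unfolding D_def by blast
    then show ?thesis
      unfolding D_def by (auto intro!: exI[of _ "smult c p"] simp: pcompose_smult smult_diff_right)
  qed
  have falling_in: "falling k \<in> D" for k
  proof -
    have "pcompose (falling (Suc k)) (X + 1) - falling (Suc k) = smult (of_nat (Suc k)) (falling k)"
      unfolding falling_shift by (simp add: falling_Suc algebra_simps smult_add_left)
    moreover have "poly (falling (Suc k)) (0 :: 'k) = 0"
      unfolding falling_def poly_prod by (intro prod_zero) auto
    ultimately have "smult (of_nat (Suc k)) (falling k) \<in> D"
      unfolding D_def by blast
    from scale[OF this, of "inverse (of_nat (Suc k))"] show ?thesis
      by (simp del: of_nat_Suc)
  qed
  \<comment> \<open>The factor \<open>falling k\<close> absorbs the powers of \<open>X\<close> that are split off from \<open>q\<close>; \<open>k = 0\<close> is the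
    claim.\<close>
  have "falling k * q \<in> D" for k
  proof (induction q arbitrary: k)
    case 0
    show ?case using scale[OF falling_in, of 0] by simp
  next
    case (pCons a q)
    have "falling k * pCons a q =
        smult a (falling k) + (falling (Suc k) * q + smult (of_nat k) (falling k * q))"
      by (simp add: falling_Suc algebra_simps)
    then show ?case
      using add[OF scale[OF falling_in] add[OF pCons.IH scale[OF pCons.IH]]] by simp
  qed
  from this[of 0] show ?thesis
    unfolding D_def by (simp add: falling_def)
qed

definition antidifference :: "'k::field_char_0 poly \<Rightarrow> 'k poly" where
  "antidifference q = (SOME p. pcompose p (X + 1) - p = q \<and> poly p 0 = 0)"

lemma antidifference:
  "pcompose (antidifference q) (X + 1) = antidifference q + q" "poly (antidifference q) 0 = 0"
  using someI_ex[OF antidifference_exists[of q]]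
  unfolding antidifference_def by (auto simp: algebra_simps)

function base_poly :: "nat \<Rightarrow> 'k::field_char_0 poly" where
  "base_poly 0 = 1"
| "base_poly (Suc n) = antidifference (\<Sum>i\<in>{..n}. base_poly i * base_poly (n - i))"
  by pat_completeness auto
termination
  by (relation "measure id") auto

lemma sum_from_one: "(\<Sum>i=1..Suc n. f (i - 1) (Suc n - i)) = (\<Sum>i\<le>n. f i (n - i))"
  for f :: "nat \<Rightarrow> nat \<Rightarrow> 'a::comm_monoid_add"
proof -
  have "(\<Sum>i=1..Suc n. f (i - 1) (Suc n - i)) = (\<Sum>i=0..n. f i (n - i))"
    using sum.shift_bounds_cl_Suc_ivl[of "\<lambda>i. f (i - 1) (Suc n - i)" 0 n] by simp
  then show ?thesis by (simp add: atLeast0AtMost)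
qed

lemma recursion_base_poly: "recursion (base_poly :: nat \<Rightarrow> 'k::field_char_0 poly)"
  unfolding recursion_def
proof (intro conjI allI impI)
  fix k :: nat assume "1 \<le> k"
  then obtain n where k: "k = Suc n" by (cases k) auto
  show "pcompose (base_poly k :: 'k poly) (X + 1) =
      base_poly k + (\<Sum>i=1..k. base_poly (i - 1) * base_poly (k - i))"
    unfolding k sum_from_one[of "\<lambda>i j. base_poly i * base_poly j :: 'k poly"]
    by (simp add: antidifference)
  show "poly (base_poly k) (0 :: 'k) = 0"
    unfolding k by (simp add: antidifference)
qed simp

lemma recursionD:
  assumes "recursion R" "k \<ge> 1"
  shows "pcompose (R k) (X + 1) = R k + (\<Sum>i=1..k. R (i - 1) * R (k - i))" "poly (R k) 0 = 0"
  using assms unfolding recursion_def by blast+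

lemma recursion_unique:
  assumes P: "recursion P" and Q: "recursion (Q :: nat \<Rightarrow> 'k::field_char_0 poly)"
  shows "Q = P"
proof
  fix k show "Q k = P k"
  proof (induction k rule: less_induct)
    case (less k)
    show ?case
    proof (cases "k = 0")
      case True
      then show ?thesis using P Q by (simp add: recursion_def)
    next
      case False
      then have "k \<ge> 1" by simp
      have "(\<Sum>i=1..k. Q (i - 1) * Q (k - i)) = (\<Sum>i=1..k. P (i - 1) * P (k - i))"
        by (intro sum.cong refl arg_cong2[of _ _ _ _ "(*)"]; rule less.IH) auto
      then have "pcompose (Q k) (X + 1) - Q k = pcompose (P k) (X + 1) - P k"
        unfolding recursionD(1)[OF P \<open>k \<ge> 1\<close>] recursionD(1)[OF Q \<open>k \<ge> 1\<close>] by simp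
      then show ?thesis
        by (rule antidifference_unique) (simp only: recursionD(2)[OF P \<open>k \<ge> 1\<close>] recursionD(2)[OF Q \<open>k \<ge> 1\<close>])
    qed
  qed
qed

section \<open>Evaluating the coproduct at \<open>(1, x)\<close>\<close>

lemma monomial_mult: "monomial m * monomial n = monomial (m + n)"
  by (simp add: monomial_def mult_single)

lemma monomial_zero: "monomial 0 = 1"
  by (simp add: monomial_def)

lemma restrict_monomial: "\<exists>m. restrict Y = monomial m"
  by (metis restrict_def gen_def monomial_zero)

text \<open>
  Both tensor factors in the coproduct of a generator are monomials, so \<open>\<phi> \<otimes> \<phi>\<close> can be computed on
  each summand directly from its definition on pairs of monomials.
\<close>

lemma restrict_ideal_monomial: "\<exists>m. restrict_ideal J = monomial m"
proof -
  have "\<exists>m. (\<Prod>i\<in>A. f i) = monomial m" if f: "\<And>i. \<exists>m. f i = monomial m"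
    for A :: "nat set set" and f :: "nat set \<Rightarrow> 'k::field KNCP"
  proof (induction A rule: infinite_finite_induct)
    case (infinite A)
    then show ?case using monomial_zero by (metis prod.infinite)
  next
    case empty
    show ?case using monomial_zero by (metis prod.empty)
  next
    case (insert a A)
    obtain m n where "f a = monomial m" "prod f A = monomial n"
      using f[of a] insert.IH by blast
    then have "prod f (insert a A) = monomial (m + n)"
      using insert.hyps by (simp add: monomial_mult)
    then show ?case by blast
  qed
  from this[OF restrict_monomial] show ?thesis
    unfolding restrict_ideal_def .
qed

lemma tensor_monomial: "tensor (monomial m) (monomial n) = Poly_Mapping.single (m, n) 1"
  by (simp add: tensor_def monomial_def)

lemma extend_gen: "extend \<iota> f (gen \<pi>) = \<iota> 1 * f \<pi>"
  by (simp add: extend_def gen_def monomial_def)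

lemma tensor_map_superset:
  assumes "finite K" "Poly_Mapping.keys t \<subseteq> K"
  shows "tensor_map \<phi> t = (\<Sum>(m, n)\<in>K.
     [:[:Poly_Mapping.lookup t (m, n):]:] * poly_tensor (\<phi> (monomial m)) (\<phi> (monomial n)))"
  unfolding tensor_map_def
  using assms by (intro sum.mono_neutral_left) (auto simp: in_keys_iff)

lemma tensor_map_add: "tensor_map \<phi> (s + t) = tensor_map \<phi> s + tensor_map \<phi> t"
proof -
  let ?K = "Poly_Mapping.keys s \<union> Poly_Mapping.keys t"
  have K: "finite ?K" "Poly_Mapping.keys (s + t) \<subseteq> ?K"
    "Poly_Mapping.keys s \<subseteq> ?K" "Poly_Mapping.keys t \<subseteq> ?K"
    using Poly_Mapping.keys_add[of s t] by auto
  show ?thesis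
    unfolding tensor_map_superset[OF K(1,2)] tensor_map_superset[OF K(1,3)]
      tensor_map_superset[OF K(1,4)] sum.distrib[symmetric]
  proof (rule sum.cong[OF refl], clarify)
    fix m n
    have "[:[:Poly_Mapping.lookup (s + t) (m, n):]:] =
        [:[:Poly_Mapping.lookup s (m, n):]:] + [:[:Poly_Mapping.lookup t (m, n):]:]"
      by (simp add: lookup_add)
    then show "[:[:Poly_Mapping.lookup (s + t) (m, n):]:] *
          poly_tensor (\<phi> (monomial m)) (\<phi> (monomial n)) =
        [:[:Poly_Mapping.lookup s (m, n):]:] * poly_tensor (\<phi> (monomial m)) (\<phi> (monomial n)) +
        [:[:Poly_Mapping.lookup t (m, n):]:] * poly_tensor (\<phi> (monomial m)) (\<phi> (monomial n))"
      by (metis distrib_right)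
  qed
qed

lemma tensor_map_sum: "tensor_map \<phi> (\<Sum>i\<in>A. t i) = (\<Sum>i\<in>A. tensor_map \<phi> (t i))"
  by (induction A rule: infinite_finite_induct)
    (simp_all add: tensor_map_add, simp_all add: tensor_map_def)

lemma tensor_map_tensor_monomial:
  "tensor_map \<phi> (tensor (monomial m) (monomial n)) =
    poly_tensor (\<phi> (monomial m)) (\<phi> (monomial n))"
  by (simp add: tensor_monomial tensor_map_def flip: one_pCons)

lemma Delta_poly_gen:
  assumes "double_bialgebra_morphism \<phi>"
  shows "Delta_poly (\<phi> (gen \<pi>)) = (\<Sum>J\<in>ideals \<pi>.
    poly_tensor (\<phi> (restrict (blocks \<pi> - J))) (\<phi> (restrict_ideal J)))"
proof -
  have "tensor_map \<phi> (tensor (restrict Y) (restrict_ideal J)) =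
      poly_tensor (\<phi> (restrict Y)) (\<phi> (restrict_ideal J))" for Y J
    by (metis restrict_monomial restrict_ideal_monomial tensor_map_tensor_monomial)
  then show ?thesis
    using assms
    by (simp add: double_bialgebra_morphism_def Delta_NCP_def extend_gen tensor_map_sum)
qed

text \<open>
  The right tensor factor lives in the outer variable, which is specialised to \<open>x\<close> first; the left
  factor then takes \<open>y\<close>. Such a specialisation is a ring morphism to the field.
\<close>

lemma eval_poly_tensor:
  "poly (poly (poly_tensor p q) [:x:]) y = poly p y * poly q (x :: 'k::field)"
proof -
  have "poly (map_poly (\<lambda>c. [:c:]) q) [:x:] = [:poly q x:]"
    by (induction q) (simp_all add: map_poly_pCons)
  then show ?thesis by (simp add: poly_tensor_def)
qed

lemma eval_Delta_poly: "poly (poly (Delta_poly p) [:x:]) y = poly p (x + y :: 'k::field)"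
proof -
  have "poly (poly (poly (map_poly (\<lambda>c. [:[:c:]:]) p) T) [:x:]) y =
      poly p (poly (poly T [:x:]) y)" for T
    by (induction p) (simp_all add: map_poly_pCons)
  then show ?thesis
    by (simp add: Delta_poly_def eval_poly_tensor X_def add.commute)
qed

text \<open>
  The specialisation \<open>y = 1\<close> in the left factor is the counit of \<open>\<delta>\<close>, which is easy to evaluate
  on the restriction to the complement of an ideal. For partitions
  without nesting, specialising the right factor instead would leave all sets of pairwise
  nonadjacent blocks, hence a different recursion.
\<close>

lemma morphism_shift:
  assumes "double_bialgebra_morphism \<phi>"
  shows "poly (\<phi> (gen \<pi>)) (x + 1) = (\<Sum>J\<in>ideals \<pi>.
    eps_delta (restrict (blocks \<pi> - J)) * poly (\<phi> (restrict_ideal J)) x)"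
proof -
  have eps: "poly (\<phi> a) 1 = eps_delta a" for a
    using assms by (simp add: double_bialgebra_morphism_def)
  have "poly (\<phi> (gen \<pi>)) (x + 1) = poly (poly (Delta_poly (\<phi> (gen \<pi>))) [:x:]) 1"
    by (rule eval_Delta_poly[symmetric])
  also have "\<dots> = (\<Sum>J\<in>ideals \<pi>. poly (poly (poly_tensor
      (\<phi> (restrict (blocks \<pi> - J))) (\<phi> (restrict_ideal J))) [:x:]) 1)"
    unfolding Delta_poly_gen[OF assms] poly_sum ..
  finally show ?thesis
    unfolding eval_poly_tensor eps .
qed

lemma eps_delta_one: "eps_delta 1 = 1"
  unfolding eps_delta_def extend_def keys_one lookup_one by simp

section \<open>Partitions without nesting\<close>

lemma ncp_partition:
  obtains n where "partition_on {1..n} (blocks \<pi>)" "n \<ge> 1" "noncrossing (blocks \<pi>)"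
  using blocks[of \<pi>] unfolding is_ncp_def by blast

lemma noncrossing_blocks:
  assumes "b \<in> blocks \<pi>" "c \<in> blocks \<pi>" "b \<noteq> c"
    "x \<in> b" "z \<in> b" "y \<in> c" "t \<in> c" "x < y" "y < z" "z < t"
  shows False
proof -
  have "noncrossing (blocks \<pi>)"
    using blocks[of \<pi>] unfolding is_ncp_def by simp
  with assms show False
    unfolding noncrossing_def by metis
qed

lemma finite_blocks: "finite (blocks \<pi>)"
  by (metis ncp_partition finite_elements finite_atLeastAtMost)

lemma blocks_nonempty: "blocks \<pi> \<noteq> {}"
proof
  assume "blocks \<pi> = {}"
  moreover obtain n where "partition_on {1..n} (blocks \<pi>)" "n \<ge> 1"
    by (rule ncp_partition)
  ultimately show False
    using partition_onD1 by fastforce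
qed

lemma block:
  assumes "b \<in> blocks \<pi>"
  shows "finite b" "b \<noteq> {}"
proof -
  obtain n where n: "partition_on {1..n} (blocks \<pi>)"
    by (rule ncp_partition)
  then show "b \<noteq> {}"
    using assms partition_onD3 by blast
  have "b \<subseteq> {1..n}"
    using assms partition_onD1[OF n] by blast
  then show "finite b"
    using finite_subset by blast
qed

lemma ideals_flat:
  assumes "blocks \<pi> = Base \<pi>"
  shows "ideals \<pi> = Pow (blocks \<pi>)"
proof -
  have "b = b'" if "b \<in> blocks \<pi>" "b' \<in> blocks \<pi>" "nests b b'" for b b'
    using that assms unfolding Base_def by blast
  then show ?thesis
    unfolding ideals_def by blast
qed

text \<open>
  Of two disjoint blocks let \<open>b\<close> be the one with the smaller minimum. If \<open>c\<close> starts before \<open>b\<close> ends,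
  then \<open>c\<close> either stays inside the range of \<open>b\<close>, and is nested in it, or ends after \<open>b\<close>, and then
  \<open>Min b < Min c < Max b < Max c\<close> is a crossing.
\<close>

lemma flat_separated:
  assumes flat: "blocks \<pi> = Base \<pi>" and "b \<in> blocks \<pi>" "c \<in> blocks \<pi>" "b \<noteq> c"
  shows "Max b < Min c \<or> Max c < Min b"
proof -
  obtain n where part: "partition_on {1..n} (blocks \<pi>)"
    by (rule ncp_partition)
  have *: "Max b < Min c"
    if bc: "b \<in> blocks \<pi>" "c \<in> blocks \<pi>" "b \<noteq> c" and le: "Min b \<le> Min c" for b c
  proof (rule ccontr)
    assume "\<not> Max b < Min c"
    have mem: "Min b \<in> b" "Max b \<in> b" "Min c \<in> c" "Max c \<in> c"
      using block[OF bc(1)] block[OF bc(2)] by simp_all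
    have "b \<inter> c = {}"
      using partition_onD2[OF part] bc by (meson disjointD)
    then have "Min b \<noteq> Min c" "Max b \<noteq> Min c"
      using mem by (metis disjoint_iff)+
    then have "Min b < Min c" "Min c < Max b"
      using le \<open>\<not> Max b < Min c\<close> by auto
    have "Max c \<le> Max b"
    proof (rule ccontr)
      assume "\<not> Max c \<le> Max b"
      then have "Max b < Max c" by simp
      with \<open>Min b < Min c\<close> \<open>Min c < Max b\<close> show False
        by (rule noncrossing_blocks[OF bc(1,2,3) mem])
    qed
    have "nests b c"
      unfolding nests_def
    proof
      fix x assume "x \<in> c"
      then have "Min c \<le> x" "x \<le> Max c"
        using block(1)[OF bc(2)] by simp_all
      then show "x \<in> {Min b..Max b}"
        using le \<open>Max c \<le> Max b\<close> by simp
    qed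
    then show False
      using bc flat unfolding Base_def by blast
  qed
  show ?thesis
    using *[OF assms(2,3,4)] *[OF assms(3,2) assms(4)[symmetric]] nat_le_linear by blast
qed

definition blocks_before :: "ncp \<Rightarrow> nat set \<Rightarrow> nat set set" where
  "blocks_before \<pi> b = {c \<in> blocks \<pi>. Max c < Min b}"

definition blocks_after :: "ncp \<Rightarrow> nat set \<Rightarrow> nat set set" where
  "blocks_after \<pi> b = {c \<in> blocks \<pi>. Max b < Min c}"

lemma card_before_after:
  assumes flat: "blocks \<pi> = Base \<pi>" and b: "b \<in> blocks \<pi>"
  shows "card (blocks \<pi>) = Suc (card (blocks_before \<pi> b) + card (blocks_after \<pi> b))"
proof -
  have le: "Min c \<le> Max c" if "c \<in> blocks \<pi>" for c
    using block[OF that] by simp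
  have eq: "blocks \<pi> = insert b (blocks_before \<pi> b \<union> blocks_after \<pi> b)"
    using flat_separated[OF flat b] b unfolding blocks_before_def blocks_after_def by blast
  have notin: "b \<notin> blocks_before \<pi> b \<union> blocks_after \<pi> b"
    using le[OF b] unfolding blocks_before_def blocks_after_def by auto
  have disj: "blocks_before \<pi> b \<inter> blocks_after \<pi> b = {}"
    using le le[OF b] unfolding blocks_before_def blocks_after_def by force
  have fin: "finite (blocks_before \<pi> b)" "finite (blocks_after \<pi> b)"
    using finite_blocks unfolding blocks_before_def blocks_after_def by simp_all
  have "card (blocks \<pi>) = card (insert b (blocks_before \<pi> b \<union> blocks_after \<pi> b))"
    by (rule arg_cong[OF eq])
  also have "\<dots> = Suc (card (blocks_before \<pi> b) + card (blocks_after \<pi> b))"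
    unfolding card_insert_disjoint[OF finite_UnI[OF fin] notin] card_Un_disjoint[OF fin disj] ..
  finally show ?thesis .
qed

text \<open>
  Numbering the blocks from left to right, so that the sum over blocks becomes the sum over \<open>i\<close> in
  the recursion.
\<close>

lemma before_bij:
  assumes flat: "blocks \<pi> = Base \<pi>"
  shows "bij_betw (\<lambda>b. Suc (card (blocks_before \<pi> b))) (blocks \<pi>) {1..card (blocks \<pi>)}"
proof -
  let ?f = "\<lambda>b. Suc (card (blocks_before \<pi> b))"
  have less: "?f b < ?f c" if "b \<in> blocks \<pi>" "c \<in> blocks \<pi>" "Max b < Min c" for b c
  proof -
    have le: "Min b \<le> Max b"
      using block[OF that(1)] by simp
    have "blocks_before \<pi> b \<subset> blocks_before \<pi> c"
    proof (rule psubsetI)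
      show "blocks_before \<pi> b \<subseteq> blocks_before \<pi> c"
        using that le unfolding blocks_before_def by auto
      have "b \<in> blocks_before \<pi> c" "b \<notin> blocks_before \<pi> b"
        using that le unfolding blocks_before_def by auto
      then show "blocks_before \<pi> b \<noteq> blocks_before \<pi> c"
        by blast
    qed
    then show ?thesis
      using finite_blocks by (simp add: blocks_before_def psubset_card_mono)
  qed
  have inj: "inj_on ?f (blocks \<pi>)"
  proof (rule inj_onI, rule ccontr)
    fix b c assume "b \<in> blocks \<pi>" "c \<in> blocks \<pi>" "?f b = ?f c" "b \<noteq> c"
    then show False
      using flat_separated[OF flat, of b c] less[of b c] less[of c b] by auto
  qed
  have "?f ` blocks \<pi> = {1..card (blocks \<pi>)}"
  proof (rule card_subset_eq)
    show "?f ` blocks \<pi> \<subseteq> {1..card (blocks \<pi>)}"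
      using card_before_after[OF flat] by auto
  qed (simp_all add: card_image[OF inj])
  then show ?thesis
    using inj by (simp add: bij_betw_def)
qed

lemma blocks_restriction:
  assumes Y: "Y \<subseteq> blocks \<pi>" "Y \<noteq> {}"
  shows "blocks (Abs_ncp (relabel Y)) = relabel Y"
  using Abs_ncp_inverse is_ncp_relabel[OF Y] by simp

text \<open>
  Renumbering by an order embedding: monotonicity alone gives the number of blocks and their
  nesting, without the formula for the new labels.
\<close>

lemma relabel_order:
  assumes "Y \<subseteq> blocks \<pi>"
  obtains g :: "nat \<Rightarrow> nat" where "relabel Y = (`) g ` Y" "strict_mono_on (\<Union>Y) g"
proof
  define g where "g x = card {y \<in> \<Union>Y. y \<le> x}" for x
  show "relabel Y = (`) g ` Y"
    unfolding relabel_def g_def by simp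
  have "finite Y"
    using assms finite_blocks finite_subset by blast
  then have fin: "finite (\<Union>Y)"
  proof (rule finite_Union)
    show "finite b" if "b \<in> Y" for b
      using that assms by (intro block(1)) (rule subsetD)
  qed
  show "strict_mono_on (\<Union>Y) g"
  proof (rule strict_mono_onI)
    fix x y assume xy: "x \<in> \<Union>Y" "y \<in> \<Union>Y" "x < y"
    have "y \<in> {z \<in> \<Union>Y. z \<le> y}" "y \<notin> {z \<in> \<Union>Y. z \<le> x}"
      using xy by simp_all
    moreover have "{z \<in> \<Union>Y. z \<le> x} \<subseteq> {z \<in> \<Union>Y. z \<le> y}"
      using xy by auto
    ultimately have "{z \<in> \<Union>Y. z \<le> x} \<subset> {z \<in> \<Union>Y. z \<le> y}"
      by blast
    then show "g x < g y"
      unfolding g_def using fin by (intro psubset_card_mono) simp_all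
  qed
qed

lemma card_relabel:
  assumes "Y \<subseteq> blocks \<pi>"
  shows "card (relabel Y) = card Y"
proof -
  obtain g where g: "relabel Y = (`) g ` Y" "strict_mono_on (\<Union>Y) g"
    by (rule relabel_order[OF assms])
  have "inj_on g (\<Union>Y)"
    using g(2) by (rule strict_mono_on_imp_inj_on)
  from card_image[OF inj_on_image[OF this]] show ?thesis
    unfolding g(1) .
qed

text \<open>
  Nesting expressed by comparisons between elements only, a form that an order embedding visibly
  preserves and reflects.
\<close>

lemma nests_iff:
  assumes "finite b" "b \<noteq> {}"
  shows "nests b c \<longleftrightarrow> (\<forall>x\<in>c. \<exists>u\<in>b. \<exists>v\<in>b. u \<le> x \<and> x \<le> v)"
proof -
  have "Min b \<le> x \<longleftrightarrow> (\<exists>u\<in>b. u \<le> x)" "x \<le> Max b \<longleftrightarrow> (\<exists>v\<in>b. x \<le> v)" for x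
    using assms by (simp_all add: Min_le_iff Max_ge_iff)
  then show ?thesis
    unfolding nests_def by auto
qed

text \<open>
  Renumbering reflects nesting, so a nesting in the restriction would already be one in \<open>\<pi>\<close>.
\<close>

lemma flat_restriction:
  assumes flat: "blocks \<pi> = Base \<pi>" and Y: "Y \<subseteq> blocks \<pi>" "Y \<noteq> {}"
  shows "blocks (Abs_ncp (relabel Y)) = Base (Abs_ncp (relabel Y))"
proof -
  obtain g where g: "relabel Y = (`) g ` Y" "strict_mono_on (\<Union>Y) g"
    by (rule relabel_order[OF Y(1)])
  have le: "x \<le> y" if "g x \<le> g y" "x \<in> \<Union>Y" "y \<in> \<Union>Y" for x y
    using strict_mono_onD[OF g(2) that(3,2)] that(1) by (meson not_le)
  have eq: "b = c" if bc: "b \<in> Y" "c \<in> Y" and n: "nests (g ` b) (g ` c)" for b c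
  proof -
    have b: "finite b" "b \<noteq> {}"
      using block bc(1) Y(1) by blast+
    have "\<exists>u\<in>b. \<exists>v\<in>b. u \<le> x \<and> x \<le> v" if "x \<in> c" for x
    proof -
      have "\<forall>z\<in>g ` c. \<exists>u\<in>g ` b. \<exists>v\<in>g ` b. u \<le> z \<and> z \<le> v"
        using n b by (simp only: nests_iff finite_imageI image_is_empty not_False_eq_True)
      from bspec[OF this imageI[OF that]]
      have "\<exists>u\<in>b. \<exists>v\<in>b. g u \<le> g x \<and> g x \<le> g v"
        by simp
      then obtain u v where uv: "u \<in> b" "v \<in> b" "g u \<le> g x" "g x \<le> g v"
        by blast
      have "u \<in> \<Union>Y" "v \<in> \<Union>Y" "x \<in> \<Union>Y"
        using uv bc that by blast+
      then have "u \<le> x" "x \<le> v"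
        using le uv by simp_all
      then show ?thesis
        using uv by blast
    qed
    then have "nests b c"
      using b by (subst nests_iff) auto
    then show ?thesis
      using flat bc Y(1) unfolding Base_def by blast
  qed
  have "p = q" if pq: "p \<in> relabel Y" "q \<in> relabel Y" "nests p q" for p q
  proof -
    obtain b c where bc: "b \<in> Y" "p = g ` b" "c \<in> Y" "q = g ` c"
      using pq unfolding g(1) by (elim imageE)
    then show ?thesis
      using eq[OF bc(1,3)] pq(3) by simp
  qed
  then show ?thesis
    unfolding Base_def blocks_restriction[OF Y] by blast
qed

lemma eps_delta_restrict:
  assumes "Y \<subseteq> blocks \<pi>"
  shows "eps_delta (restrict Y) = (if card Y \<le> 1 then 1 else 0)"
proof (cases "Y = {}")
  case True
  then show ?thesis by (simp add: restrict_def eps_delta_one)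
next
  case False
  have "finite Y"
    using assms finite_blocks finite_subset by blast
  then have "card Y \<noteq> 0"
    using False by simp
  then have "card Y = 1 \<longleftrightarrow> card Y \<le> 1"
    by linarith
  then show ?thesis
    using False assms
    by (simp add: restrict_def eps_delta_def extend_gen blocks_restriction card_relabel
        del: One_nat_def)
qed

text \<open>
  A run of consecutive integers cannot cross the gap \<open>{c..d}\<close>. Either side may be empty, and then it
  is not one of the maximal runs.
\<close>

lemma intervals_gap:
  assumes "c \<le> d"
  shows "intervals ({1..<c} \<union> {d<..n}) = {{1..<c}, {d<..n}} - {{}}"
proof -
  let ?A = "{1..<c}" and ?B = "{d<..n}"
  have A: "?A = {1..c - 1}" and B: "?B = {Suc d..n}"
    by auto
  have inside: "{x..y} \<subseteq> ?A \<or> {x..y} \<subseteq> ?B" if "{x..y} \<subseteq> ?A \<union> ?B" for x y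
  proof (rule ccontr)
    assume no: "\<not> ?thesis"
    then have xy: "x \<le> y" by auto
    then have "x \<in> ?A \<union> ?B" "y \<in> ?A \<union> ?B"
      using that by auto
    then have "x < c" "d < y"
      using no assms by auto
    then have "c \<in> {x..y}"
      using assms by auto
    then have "c \<in> ?A \<union> ?B"
      using that by blast
    then show False
      using assms by auto
  qed
  have disj: "?A \<inter> ?B = {}"
    using assms by auto
  show ?thesis
  proof (intro equalityI subsetI)
    fix I assume "I \<in> intervals (?A \<union> ?B)"
    then obtain x y where I: "I \<noteq> {}" "I = {x..y}" "I \<subseteq> ?A \<union> ?B"
      and max: "\<And>a b. I \<subseteq> {a..b} \<Longrightarrow> {a..b} \<subseteq> ?A \<union> ?B \<Longrightarrow> {a..b} = I"
      unfolding intervals_def by blast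
    have "I \<subseteq> ?A \<or> I \<subseteq> ?B"
      using inside I by blast
    then have "I = ?A \<or> I = ?B"
      using max[of 1 "c - 1"] max[of "Suc d" n] unfolding A[symmetric] B[symmetric] by blast
    then show "I \<in> {?A, ?B} - {{}}"
      using I(1) by blast
  next
    fix I assume I: "I \<in> {?A, ?B} - {{}}"
    have "{x..y} = I" if "I \<subseteq> {x..y}" "{x..y} \<subseteq> ?A \<union> ?B" for x y
      using inside[OF that(2)] I that disj by blast
    moreover have "\<exists>a b. I = {a..b}"
      using I A B by blast
    ultimately show "I \<in> intervals (?A \<union> ?B)"
      using I unfolding intervals_def by blast
  qed
qed

text \<open>
  The union of all blocks is a single run, and renumbering \<open>{1..n}\<close> changes nothing.
\<close>

lemma restrict_ideal_blocks:
  "restrict_ideal (blocks \<pi>) = gen \<pi>"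
proof -
  obtain n where n: "partition_on {1..n} (blocks \<pi>)" "n \<ge> 1"
    by (rule ncp_partition)
  have U: "\<Union>(blocks \<pi>) = {1..n}"
    using partition_onD1[OF n(1)] by simp
  \<comment> \<open>The whole of \<open>{1..n}\<close> is the left side of a gap placed just behind it.\<close>
  have "{1..<Suc n} = {1..n}" "{Suc n<..n} = {}"
    by auto
  then have "intervals {1..n} = {{1..n}, {}} - {{}}"
    using intervals_gap[of "Suc n" "Suc n" n] by (simp only: Un_empty_right le_refl)
  moreover have "{1..n} \<noteq> {}"
    using n(2) by simp
  ultimately have "intervals {1..n} = {{1..n}}"
    by blast
  moreover have "{b \<in> blocks \<pi>. b \<subseteq> {1..n}} = blocks \<pi>"
  proof (intro equalityI subsetI)
    fix b assume b: "b \<in> blocks \<pi>"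
    then have "b \<subseteq> {1..n}"
      unfolding U[symmetric] by (rule Union_upper)
    with b show "b \<in> {b \<in> blocks \<pi>. b \<subseteq> {1..n}}"
      by (intro CollectI conjI)
  qed simp
  moreover have "relabel (blocks \<pi>) = blocks \<pi>"
  proof -
    have "(\<lambda>x. card {y \<in> {1..n}. y \<le> x}) ` b = b" if "b \<in> blocks \<pi>" for b
    proof -
      have "card {y \<in> {1..n}. y \<le> x} = x" if "x \<in> b" for x
      proof -
        have "x \<in> {1..n}"
          unfolding U[symmetric] using that \<open>b \<in> blocks \<pi>\<close> by (rule UnionI[rotated])
        have "{y \<in> {1..n}. y \<le> x} = {1..x}"
          using \<open>x \<in> {1..n}\<close> by auto
        then show ?thesis by simp
      qed
      then show ?thesis by simp
    qed
    then show ?thesis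
      unfolding relabel_def U by simp
  qed
  ultimately show ?thesis
    unfolding restrict_ideal_def U
    by (simp add: restrict_def blocks_nonempty blocks_inverse)
qed

text \<open>
  Since all other blocks lie completely to the left or to the right of \<open>b\<close>, the elements outside
  them are exactly those of \<open>{Min b..Max b}\<close>, and the two sides of this gap are the runs.
\<close>

lemma restrict_ideal_remove_block:
  assumes flat: "blocks \<pi> = Base \<pi>" and b: "b \<in> blocks \<pi>"
  shows "restrict_ideal (blocks \<pi> - {b}) =
    restrict (blocks_before \<pi> b) * restrict (blocks_after \<pi> b)"
proof -
  obtain n where n: "partition_on {1..n} (blocks \<pi>)"
    by (rule ncp_partition)
  have U: "\<Union>(blocks \<pi>) = {1..n}"
    using partition_onD1[OF n] by simp
  have bounds: "Min c \<le> x" "x \<le> Max c" if "c \<in> blocks \<pi>" "x \<in> c" for c x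
    using block(1)[OF that(1)] that(2) by simp_all
  have mem: "Min c \<in> c" "Max c \<in> c" if "c \<in> blocks \<pi>" for c
    using block[OF that] by simp_all
  have le: "Min c \<le> Max c" if "c \<in> blocks \<pi>" for c
    using block[OF that] by simp
  let ?A = "{1..<Min b}" and ?B = "{Max b<..n}"
  have "\<Union>(blocks \<pi> - {b}) = ?A \<union> ?B"
  proof (intro equalityI subsetI)
    fix x assume "x \<in> \<Union>(blocks \<pi> - {b})"
    then obtain c where c: "c \<in> blocks \<pi>" "c \<noteq> b" "x \<in> c"
      by blast
    then have "x \<in> {1..n}"
      using U by blast
    then show "x \<in> ?A \<union> ?B"
      using flat_separated[OF flat b c(1)] bounds[OF c(1,3)] c(2) by auto
  next
    fix x assume x: "x \<in> ?A \<union> ?B"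
    have "Max b \<in> {1..n}" "Min b \<in> {1..n}"
      using U b mem[OF b] by blast+
    then have "x \<in> {1..n}"
      using x le[OF b] by auto
    then obtain c where c: "c \<in> blocks \<pi>" "x \<in> c"
      using U by blast
    then have "c \<noteq> b"
      using x bounds[OF c] by auto
    then show "x \<in> \<Union>(blocks \<pi> - {b})"
      using c by blast
  qed
  then have ints: "intervals (\<Union>(blocks \<pi> - {b})) = {?A, ?B} - {{}}"
    using intervals_gap[OF le[OF b]] by simp
  have pos: "c \<subseteq> {1..n}" if "c \<in> blocks \<pi>" for c
    using U that by blast
  have A: "{c \<in> blocks \<pi> - {b}. c \<subseteq> ?A} = blocks_before \<pi> b"
  proof (intro equalityI subsetI)
    fix c assume c: "c \<in> {c \<in> blocks \<pi> - {b}. c \<subseteq> ?A}"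
    then have "Max c \<in> ?A"
      using mem by blast
    then show "c \<in> blocks_before \<pi> b"
      using c by (auto simp: blocks_before_def)
  next
    fix c assume c: "c \<in> blocks_before \<pi> b"
    then have "x \<in> ?A" if "x \<in> c" for x
      using bounds[of c x] that pos[of c] by (auto simp: blocks_before_def)
    moreover have "c \<noteq> b"
      using c le[OF b] by (auto simp: blocks_before_def)
    ultimately show "c \<in> {c \<in> blocks \<pi> - {b}. c \<subseteq> ?A}"
      using c by (auto simp: blocks_before_def)
  qed
  have B: "{c \<in> blocks \<pi> - {b}. c \<subseteq> ?B} = blocks_after \<pi> b"
  proof (intro equalityI subsetI)
    fix c assume c: "c \<in> {c \<in> blocks \<pi> - {b}. c \<subseteq> ?B}"
    then have "Min c \<in> ?B"
      using mem by blast
    then show "c \<in> blocks_after \<pi> b"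
      using c by (auto simp: blocks_after_def)
  next
    fix c assume c: "c \<in> blocks_after \<pi> b"
    then have "x \<in> ?B" if "x \<in> c" for x
      using bounds[of c x] that pos[of c] by (auto simp: blocks_after_def)
    moreover have "c \<noteq> b"
      using c le[OF b] by (auto simp: blocks_after_def)
    ultimately show "c \<in> {c \<in> blocks \<pi> - {b}. c \<subseteq> ?B}"
      using c by (auto simp: blocks_after_def)
  qed
  let ?F = "\<lambda>I. restrict {c \<in> blocks \<pi> - {b}. c \<subseteq> I} :: 'a KNCP"
  have "{c \<in> blocks \<pi> - {b}. c \<subseteq> {}} = {}"
    using block(2) by blast
  then have empty: "?F {} = 1"
    by (simp only: restrict_def if_True simp_thms)
  \<comment> \<open>An empty side is missing from the set of runs, but its factor would be \<open>1\<close>; the two sides can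
    coincide only when both are empty.\<close>
  have "?A \<noteq> ?B \<or> ?A = {} \<and> ?B = {}"
    using le[OF b] by fastforce
  then have "prod ?F ({?A, ?B} - {{}}) = ?F ?A * ?F ?B"
  proof
    assume "?A = {} \<and> ?B = {}"
    then show ?thesis using empty by simp
  next
    assume "?A \<noteq> ?B"
    moreover have "prod ?F ({?A, ?B} - {{}}) = prod ?F {?A, ?B}"
      using empty by (intro prod.mono_neutral_left) auto
    ultimately show ?thesis by simp
  qed
  then show ?thesis
    unfolding restrict_ideal_def ints A B .
qed

section \<open>The value of the morphism\<close>

lemma sum_Pow_corank_le_one:
  fixes F :: "'b set \<Rightarrow> 'a::comm_ring_1"
  assumes "finite S"
  shows "(\<Sum>J\<in>Pow S. (if card (S - J) \<le> 1 then 1 else 0) * F J) = F S + (\<Sum>b\<in>S. F (S - {b}))"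
proof -
  have fin: "finite (S - J)" for J
    using assms by simp
  have "J = S \<or> (\<exists>b\<in>S. J = S - {b})" if "J \<subseteq> S" "card (S - J) \<le> 1" for J
  proof -
    have "card (S - J) = 0 \<or> card (S - J) = 1"
      using that(2) by linarith
    then show ?thesis
    proof
      assume "card (S - J) = 0"
      then show ?thesis using fin that(1) by auto
    next
      assume "card (S - J) = 1"
      then obtain b where "S - J = {b}"
        by (rule card_1_singletonE)
      then show ?thesis using that(1) by blast
    qed
  qed
  moreover have "card (S - (S - {b})) \<le> 1" if "b \<in> S" for b
  proof -
    have "S - (S - {b}) = {b}"
      using that by blast
    then show ?thesis by simp
  qed
  ultimately have eq: "{J \<in> Pow S. card (S - J) \<le> 1} = insert S ((\<lambda>b. S - {b}) ` S)"
    by auto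
  have "(\<Sum>J\<in>Pow S. (if card (S - J) \<le> 1 then 1 else 0) * F J) =
      (\<Sum>J\<in>{J \<in> Pow S. card (S - J) \<le> 1}. F J)"
    using assms by (intro sum.mono_neutral_cong_right) auto
  also have "\<dots> = F S + (\<Sum>J\<in>(\<lambda>b. S - {b}) ` S. F J)"
    unfolding eq using assms by (intro sum.insert) auto
  also have "(\<Sum>J\<in>(\<lambda>b. S - {b}) ` S. F J) = (\<Sum>b\<in>S. F (S - {b}))"
    by (rule sum.reindex_cong[OF _ refl refl]) (auto simp: inj_on_def)
  finally show ?thesis .
qed

text \<open>
  The recursion in intrinsic form: a sum over the deleted block, before the blocks are numbered and
  the values on the two sides are known.
\<close>

lemma morphism_flat_shift:
  assumes \<phi>: "double_bialgebra_morphism (\<phi> :: 'k::field_char_0 KNCP \<Rightarrow> 'k poly)"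
    and flat: "blocks \<pi> = Base \<pi>"
  shows "pcompose (\<phi> (gen \<pi>)) (X + 1) = \<phi> (gen \<pi>) +
    (\<Sum>b\<in>blocks \<pi>. \<phi> (restrict (blocks_before \<pi> b)) * \<phi> (restrict (blocks_after \<pi> b)))"
    (is "_ = ?R")
proof -
  have mult: "\<phi> (a * b) = \<phi> a * \<phi> b" for a b
    using \<phi> unfolding double_bialgebra_morphism_def algebra_morphism_def by blast
  have "poly (pcompose (\<phi> (gen \<pi>)) (X + 1)) x = poly ?R x" for x
  proof -
    let ?F = "\<lambda>J. poly (\<phi> (restrict_ideal J)) x"
    have "poly (pcompose (\<phi> (gen \<pi>)) (X + 1)) x =
        (\<Sum>J\<in>Pow (blocks \<pi>). eps_delta (restrict (blocks \<pi> - J)) * ?F J)"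
      unfolding poly_shift morphism_shift[OF \<phi>] ideals_flat[OF flat] ..
    also have "\<dots> = (\<Sum>J\<in>Pow (blocks \<pi>). (if card (blocks \<pi> - J) \<le> 1 then 1 else 0) * ?F J)"
      by (simp only: eps_delta_restrict[OF Diff_subset])
    also have "\<dots> = ?F (blocks \<pi>) + (\<Sum>b\<in>blocks \<pi>. ?F (blocks \<pi> - {b}))"
      by (rule sum_Pow_corank_le_one[OF finite_blocks])
    also have "(\<Sum>b\<in>blocks \<pi>. ?F (blocks \<pi> - {b})) = (\<Sum>b\<in>blocks \<pi>.
        poly (\<phi> (restrict (blocks_before \<pi> b)) * \<phi> (restrict (blocks_after \<pi> b))) x)"
      by (rule sum.cong[OF refl]) (simp only: restrict_ideal_remove_block[OF flat] mult)
    also have "?F (blocks \<pi>) + \<dots> = poly ?R x"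
      unfolding restrict_ideal_blocks poly_add poly_sum ..
    finally show ?thesis .
  qed
  then have "poly (pcompose (\<phi> (gen \<pi>)) (X + 1)) = poly ?R"
    by (rule ext)
  then show ?thesis
    by (simp only: poly_eq_poly_eq_iff)
qed

text \<open>
  Both sides of a deleted block have fewer blocks than \<open>\<pi>\<close>, so their values are known by induction;
  an empty side is sent to \<open>P 0 = 1\<close>. Then \<open>\<phi>(\<pi>)\<close> and \<open>P k\<close> have the same difference and both
  vanish at \<open>0\<close>.
\<close>

lemma morphism_flat:
  assumes \<phi>: "double_bialgebra_morphism (\<phi> :: 'k::field_char_0 KNCP \<Rightarrow> 'k poly)"
    and P: "recursion P" and flat: "blocks \<pi> = Base \<pi>"
  shows "\<phi> (gen \<pi>) = P (card (blocks \<pi>))"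
  using flat
proof (induction "card (blocks \<pi>)" arbitrary: \<pi> rule: less_induct)
  case less
  let ?k = "card (blocks \<pi>)"
  have k: "?k \<ge> 1"
    using blocks_nonempty finite_blocks by (simp add: Suc_le_eq card_gt_0_iff)
  have restriction: "\<phi> (restrict Y) = P (card Y)" if Y: "Y \<subseteq> blocks \<pi>" "card Y < ?k" for Y
  proof (cases "Y = {}")
    case True
    have "\<phi> 1 = 1"
      using \<phi> unfolding double_bialgebra_morphism_def algebra_morphism_def
      by (metis one_pCons single_one)
    then show ?thesis
      using True P by (simp add: restrict_def recursion_def)
  next
    case False
    have "card (blocks (Abs_ncp (relabel Y))) = card Y"
      by (simp add: blocks_restriction[OF Y(1) False] card_relabel[OF Y(1)])
    then show ?thesis
      using less.hyps[OF _ flat_restriction[OF less.prems Y(1) False]] Y(2) False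
      by (simp add: restrict_def)
  qed
  have "\<phi> (restrict (blocks_before \<pi> b)) * \<phi> (restrict (blocks_after \<pi> b)) =
      P (Suc (card (blocks_before \<pi> b)) - 1) * P (?k - Suc (card (blocks_before \<pi> b)))"
    if "b \<in> blocks \<pi>" for b
  proof -
    have "blocks_before \<pi> b \<subseteq> blocks \<pi>" "blocks_after \<pi> b \<subseteq> blocks \<pi>"
      by (auto simp: blocks_before_def blocks_after_def)
    then show ?thesis
      using card_before_after[OF less.prems that] by (simp add: restriction)
  qed
  then have "(\<Sum>b\<in>blocks \<pi>. \<phi> (restrict (blocks_before \<pi> b)) * \<phi> (restrict (blocks_after \<pi> b))) =
      (\<Sum>i=1..?k. P (i - 1) * P (?k - i))"
    unfolding sum.reindex_bij_betw[OF before_bij[OF less.prems],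
        of "\<lambda>i. P (i - 1) * P (?k - i)", symmetric]
    by (rule sum.cong[OF refl])
  then have "pcompose (\<phi> (gen \<pi>)) (X + 1) - \<phi> (gen \<pi>) = (\<Sum>i=1..?k. P (i - 1) * P (?k - i))"
    unfolding morphism_flat_shift[OF \<phi> less.prems] by simp
  also have "\<dots> = pcompose (P ?k) (X + 1) - P ?k"
    unfolding recursionD(1)[OF P k] by simp
  finally show ?case
  proof (rule antidifference_unique)
    have "poly (\<phi> (gen \<pi>)) 0 = eps_Delta (gen \<pi>)"
      using \<phi> unfolding double_bialgebra_morphism_def by blast
    then show "poly (\<phi> (gen \<pi>)) 0 = poly (P ?k) 0"
      by (simp add: recursionD(2)[OF P k] eps_Delta_def extend_gen)
  qed
qed

theorem proposition3p7:
  shows "\<exists>P :: nat \<Rightarrow> 'k::field_char_0 poly.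
    (\<forall>Q. recursion Q \<longleftrightarrow> Q = P) \<and>
    (\<forall>\<phi> :: 'k KNCP \<Rightarrow> 'k poly. double_bialgebra_morphism \<phi> \<longrightarrow>
       (\<forall>\<pi>. blocks \<pi> = Base \<pi> \<longrightarrow> \<phi> (gen \<pi>) = P (card (blocks \<pi>))))"
proof (intro exI[of _ base_poly] conjI allI impI)
  fix Q :: "nat \<Rightarrow> 'k poly"
  show "recursion Q \<longleftrightarrow> Q = base_poly"
    using recursion_unique[OF recursion_base_poly] recursion_base_poly by blast
next
  fix \<phi> :: "'k KNCP \<Rightarrow> 'k poly" and \<pi>
  assume "double_bialgebra_morphism \<phi>" "blocks \<pi> = Base \<pi>"
  then show "\<phi> (gen \<pi>) = base_poly (card (blocks \<pi>))"
    using morphism_flat recursion_base_poly by blast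
qed

end
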